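(* Let $n\ge 0$, let $F_n$ be the free group on $n$ generators $y_1,\dots,y_n$, and let $Q_n$ be the free quandle on $n$ generators $y_1,\dots,y_n$. Then there is a group isomorphism $G_{\mathrm{Quandle}}(Q_n)\cong F_n$; that is, the logical isotropy group of the free quandle on $n$ generators is isomorphic to the free group on $n$ generators.
   Context: A quandle is a set with two binary operations $\lhd,\lhd^{-1}$ satisfying, for all $x,y,z$: $(x\lhd y)\lhd z=(x\lhd z)\lhd(y\lhd z)$; $(x\lhd^{-1}y)\lhd^{-1}z=(x\lhd^{-1}z)\lhd^{-1}(y\lhd^{-1}z)$; $(x\lhd y)\lhd^{-1}y=x$; $(x\lhd^{-1}y)\lhd y=x$; $x\lhd x=x$; $x\lhd^{-1}x=x$. We write $\lhd^{1}=\lhd$. For a finite set $X$ of constants, $\Sigma(X)$ is the signature with binary symbols $\lhd,\lhd^{-1}$ and the elements of $X$ as constants. For closed terms $s,t$ over $\Sigma(X)$, $s\sim t$ means that $s=t$ is provable from the quandle axioms over $\Sigma(X)$; $[t]$ is the $\sim$-class of $t$. The free quandle on $y_1,\dots,y_n$ is the set $Q_n$ of $\sim$-classes of closed terms over $\Sigma(y_1,\dots,y_n)$. Let $x,x_0,x_1$ be further distinct constants, and let $t[s/x]$ denote the result of replacing every occurrence of $x$ in $t$ by $s$. The logical isotropy group $G_{\mathrm{Quandle}}(Q_n)$ is the set of all classes $[t]$ of closed terms $t$ over $\Sigma(x,y_1,\dots,y_n)$ (modulo provable equality in the theory of quandles) such that: (1) $[t]$ is invertible: there is a closed term $s$ over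 $\Sigma(x,y_1,\dots,y_n)$ with $t[s/x]\sim x\sim s[t/x]$; and (2) $[t]$ commutes generically with the operations: $t[(x_0\lhd^{\epsilon} x_1)/x]\sim t[x_0/x]\lhd^{\epsilon} t[x_1/x]$ over $\Sigma(x_0,x_1,y_1,\dots,y_n)$ for $\epsilon=1$ and $\epsilon=-1$. It is a group with unit $[x]$ and product $[t]\cdot[s]=[t[s/x]]$. *)

theory Defs
  imports "HOL-Algebra.Group"
begin

section \<open>The equational theory of quandles\<close>

text \<open>
  Terms over the signature with the two binary symbols and with constants from \<open>'c\<close>. Variables
  are needed because the axioms and the derivations of equational logic involve open terms.
\<close>

datatype (constants: 'c) qterm =
    Var nat
  | Const 'c
  | Rhd "'c qterm" "'c qterm"  (infixl \<open>\<triangleleft>\<close> 65)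
  | RhdInv "'c qterm" "'c qterm"  (infixl \<open>\<triangleleft>\<^sup>-\<^sup>1\<close> 65)

primrec vars :: "'c qterm \<Rightarrow> nat set" where
  "vars (Var v) = {v}"
| "vars (Const c) = {}"
| "vars (s \<triangleleft> t) = vars s \<union> vars t"
| "vars (s \<triangleleft>\<^sup>-\<^sup>1 t) = vars s \<union> vars t"

definition terms_over :: "'c set \<Rightarrow> 'c qterm set" where
  "terms_over X = {t. constants t \<subseteq> X}"

definition closed_terms :: "'c set \<Rightarrow> 'c qterm set" where
  "closed_terms X = {t \<in> terms_over X. vars t = {}}"

primrec inst :: "(nat \<Rightarrow> 'c qterm) \<Rightarrow> 'c qterm \<Rightarrow> 'c qterm" where
  "inst \<sigma> (Var v) = \<sigma> v"
| "inst \<sigma> (Const c) = Const c"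
| "inst \<sigma> (s \<triangleleft> t) = inst \<sigma> s \<triangleleft> inst \<sigma> t"
| "inst \<sigma> (s \<triangleleft>\<^sup>-\<^sup>1 t) = inst \<sigma> s \<triangleleft>\<^sup>-\<^sup>1 inst \<sigma> t"

text \<open>\<open>replace_const c s t\<close> is \<open>t[s/c]\<close>: every occurrence of the constant \<open>c\<close> in \<open>t\<close> becomes \<open>s\<close>.\<close>

primrec replace_const :: "'c \<Rightarrow> 'c qterm \<Rightarrow> 'c qterm \<Rightarrow> 'c qterm" where
  "replace_const c s (Var v) = Var v"
| "replace_const c s (Const d) = (if d = c then s else Const d)"
| "replace_const c s (t \<triangleleft> u) = replace_const c s t \<triangleleft> replace_const c s u"
| "replace_const c s (t \<triangleleft>\<^sup>-\<^sup>1 u) = replace_const c s t \<triangleleft>\<^sup>-\<^sup>1 replace_const c s u"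

definition quandle_axioms :: "('c qterm \<times> 'c qterm) set" where
  "quandle_axioms =
    (let x = Var 0; y = Var 1; z = Var 2 in
     {((x \<triangleleft> y) \<triangleleft> z, (x \<triangleleft> z) \<triangleleft> (y \<triangleleft> z)),
      ((x \<triangleleft>\<^sup>-\<^sup>1 y) \<triangleleft>\<^sup>-\<^sup>1 z, (x \<triangleleft>\<^sup>-\<^sup>1 z) \<triangleleft>\<^sup>-\<^sup>1 (y \<triangleleft>\<^sup>-\<^sup>1 z)),
      ((x \<triangleleft> y) \<triangleleft>\<^sup>-\<^sup>1 y, x),
      ((x \<triangleleft>\<^sup>-\<^sup>1 y) \<triangleleft> y, x),
      (x \<triangleleft> x, x),
      (x \<triangleleft>\<^sup>-\<^sup>1 x, x)})"

inductive provable :: "'c set \<Rightarrow> 'c qterm \<Rightarrow> 'c qterm \<Rightarrow> bool" for X where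
  ax: "(l, r) \<in> quandle_axioms \<Longrightarrow> (\<And>v. \<sigma> v \<in> terms_over X) \<Longrightarrow>
        provable X (inst \<sigma> l) (inst \<sigma> r)"
| refl: "t \<in> terms_over X \<Longrightarrow> provable X t t"
| sym: "provable X s t \<Longrightarrow> provable X t s"
| trans: "provable X s t \<Longrightarrow> provable X t u \<Longrightarrow> provable X s u"
| cong: "provable X s s' \<Longrightarrow> provable X t t' \<Longrightarrow> provable X (s \<triangleleft> t) (s' \<triangleleft> t')"
| cong_inv: "provable X s s' \<Longrightarrow> provable X t t' \<Longrightarrow>
        provable X (s \<triangleleft>\<^sup>-\<^sup>1 t) (s' \<triangleleft>\<^sup>-\<^sup>1 t')"

definition provable_rel :: "'c set \<Rightarrow> ('c qterm \<times> 'c qterm) set" where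
  "provable_rel X = {(s, t) \<in> closed_terms X \<times> closed_terms X. provable X s t}"

definition free_quandle :: "'c set \<Rightarrow> 'c qterm set set" where
  "free_quandle X = closed_terms X // provable_rel X"


section \<open>The logical isotropy group of the free quandle\<close>

datatype qconst = X | X0 | X1 | Y nat

definition generators :: "nat \<Rightarrow> qconst set" where
  "generators n = Y ` {1..n}"

definition generically_invertible :: "nat \<Rightarrow> qconst qterm \<Rightarrow> bool" where
  "generically_invertible n t \<longleftrightarrow>
    (\<exists>s \<in> closed_terms (insert X (generators n)).
      provable (insert X (generators n)) (replace_const X s t) (Const X) \<and>
      provable (insert X (generators n)) (Const X) (replace_const X t s))"

definition commutes_generically :: "nat \<Rightarrow> qconst qterm \<Rightarrow> bool" where
  "commutes_generically n t \<longleftrightarrow>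
    provable ({X0, X1} \<union> generators n)
      (replace_const X (Const X0 \<triangleleft> Const X1) t)
      (replace_const X (Const X0) t \<triangleleft> replace_const X (Const X1) t) \<and>
    provable ({X0, X1} \<union> generators n)
      (replace_const X (Const X0 \<triangleleft>\<^sup>-\<^sup>1 Const X1) t)
      (replace_const X (Const X0) t \<triangleleft>\<^sup>-\<^sup>1 replace_const X (Const X1) t)"

text \<open>
  The isotropy group of \<open>free_quandle (generators n)\<close>. Its elements are classes
  in \<open>free_quandle (insert X (generators n))\<close>; the product is \<open>[t] \<cdot> [s] = [t[s/X]]\<close>,
  written as a union over all representatives.
\<close>

definition quandle_isotropy_group :: "nat \<Rightarrow> qconst qterm set monoid" where
  "quandle_isotropy_group n =
    (let R = provable_rel (insert X (generators n)) in
     \<lparr>carrier = {T \<in> free_quandle (insert X (generators n)).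
        \<exists>t. T = R `` {t} \<and> t \<in> closed_terms (insert X (generators n)) \<and>
            generically_invertible n t \<and> commutes_generically n t},
      monoid.mult = (\<lambda>T S. \<Union>t\<in>T. \<Union>s\<in>S. R `` {replace_const X s t}),
      one = R `` {Const X}\<rparr>)"


section \<open>Free groups\<close>

text \<open>
  A letter \<open>(True, a)\<close> stands for the generator \<open>a\<close>, and \<open>(False, a)\<close> for its formal inverse.
\<close>

definition words :: "'a set \<Rightarrow> (bool \<times> 'a) list set" where
  "words A = lists (UNIV \<times> A)"

inductive word_eq :: "'a set \<Rightarrow> (bool \<times> 'a) list \<Rightarrow> (bool \<times> 'a) list \<Rightarrow> bool" for A where
  cancel: "u \<in> words A \<Longrightarrow> v \<in> words A \<Longrightarrow> a \<in> A \<Longrightarrow>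
            word_eq A (u @ [(b, a), (\<not> b, a)] @ v) (u @ v)"
| refl: "u \<in> words A \<Longrightarrow> word_eq A u u"
| sym: "word_eq A u v \<Longrightarrow> word_eq A v u"
| trans: "word_eq A u v \<Longrightarrow> word_eq A v w \<Longrightarrow> word_eq A u w"

definition word_rel :: "'a set \<Rightarrow> ((bool \<times> 'a) list \<times> (bool \<times> 'a) list) set" where
  "word_rel A = {(u, v). word_eq A u v}"

definition free_group :: "'a set \<Rightarrow> (bool \<times> 'a) list set monoid" where
  "free_group A =
     \<lparr>carrier = words A // word_rel A,
      monoid.mult = (\<lambda>U V. \<Union>u\<in>U. \<Union>v\<in>V. word_rel A `` {u @ v}),
      one = word_rel A `` {[]}\<rparr>"

end

theory Submission
  imports Defs
begin

text \<open>
  Every closed term is provably equal to one of the form \<open>c\<close> acted on by a word \<open>w\<close> in the signed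
  constants, and the isomorphism sends the class of a word \<open>w\<close> over the generators to the class of
  \<open>act w X\<close>. Equalities are refuted in quandles built from a set \<open>S\<close> and the permutations of \<open>S\<close>:
  points act trivially, permutations act on points by application and on each other by conjugation.
  Here \<open>S\<close> is the coset space of the free group modulo the powers of \<open>X\<close>, realised as the
  reduced words not ending in \<open>X\<close> or its inverse. The letter \<open>X\<close> fixes only the trivial coset.

  Let \<open>u\<close> be a word and \<open>u'\<close> the word obtained by deleting \<open>X\<close> from it.
  If \<open>act u X\<close> commutes generically with \<open>\<triangleleft>\<close>, sending \<open>X0\<close> to a point \<open>a\<close> and
  \<open>X1\<close> to the permutation \<open>X\<close> gives \<open>u' X a = u X u\<^sup>-\<^sup>1 u' a\<close>. For \<open>a = u'\<^sup>-\<^sup>1 u 1\<close> this says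
  that \<open>X\<close> fixes \<open>a\<close>, so \<open>a = 1\<close> and \<open>u\<close>, \<open>u'\<close> agree on the trivial coset, whence
  \<open>act u X\<close> and \<open>act u' X\<close> are provably equal.
\<close>

section \<open>Equational reasoning in quandles\<close>

lemma terms_over_simps [simp]:
  "Var v \<in> terms_over C"
  "Const c \<in> terms_over C \<longleftrightarrow> c \<in> C"
  "s \<triangleleft> t \<in> terms_over C \<longleftrightarrow> s \<in> terms_over C \<and> t \<in> terms_over C"
  "s \<triangleleft>\<^sup>-\<^sup>1 t \<in> terms_over C \<longleftrightarrow> s \<in> terms_over C \<and> t \<in> terms_over C"
  by (auto simp: terms_over_def)

lemma closed_terms_simps [simp]:
  "Var v \<notin> closed_terms C"
  "Const c \<in> closed_terms C \<longleftrightarrow> c \<in> C"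
  "s \<triangleleft> t \<in> closed_terms C \<longleftrightarrow> s \<in> closed_terms C \<and> t \<in> closed_terms C"
  "s \<triangleleft>\<^sup>-\<^sup>1 t \<in> closed_terms C \<longleftrightarrow> s \<in> closed_terms C \<and> t \<in> closed_terms C"
  by (auto simp: closed_terms_def)

lemma closed_terms_subset: "t \<in> closed_terms C \<Longrightarrow> t \<in> terms_over C"
  by (simp add: closed_terms_def)

declare provable.trans [trans]

context
  fixes C :: "'c set" and s t u :: "'c qterm"
  assumes in_C: "s \<in> terms_over C" "t \<in> terms_over C" "u \<in> terms_over C"
begin

text \<open>Variables that no axiom mentions also receive \<open>u\<close>, since rule
  \<open>ax\<close> asks that every variable be sent into \<open>terms_over C\<close>.\<close>

private definition "\<sigma> v = (if v = 0 then s else if v = 1 then t else u)" for v :: nat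

private lemma ax_inst: "(l, r) \<in> quandle_axioms \<Longrightarrow> provable C (inst \<sigma> l) (inst \<sigma> r)"
  by (rule provable.ax) (auto simp: \<sigma>_def in_C)

lemma provable_axioms:
  shows "provable C ((s \<triangleleft> t) \<triangleleft> u) ((s \<triangleleft> u) \<triangleleft> (t \<triangleleft> u))"
    and "provable C ((s \<triangleleft>\<^sup>-\<^sup>1 t) \<triangleleft>\<^sup>-\<^sup>1 u) ((s \<triangleleft>\<^sup>-\<^sup>1 u) \<triangleleft>\<^sup>-\<^sup>1 (t \<triangleleft>\<^sup>-\<^sup>1 u))"
    and "provable C ((s \<triangleleft> t) \<triangleleft>\<^sup>-\<^sup>1 t) s"
    and "provable C ((s \<triangleleft>\<^sup>-\<^sup>1 t) \<triangleleft> t) s"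
    and "provable C (s \<triangleleft> s) s"
    and "provable C (s \<triangleleft>\<^sup>-\<^sup>1 s) s"
  using ax_inst[of "(Var 0 \<triangleleft> Var 1) \<triangleleft> Var 2" "(Var 0 \<triangleleft> Var 2) \<triangleleft> (Var 1 \<triangleleft> Var 2)"]
    ax_inst[of "(Var 0 \<triangleleft>\<^sup>-\<^sup>1 Var 1) \<triangleleft>\<^sup>-\<^sup>1 Var 2" "(Var 0 \<triangleleft>\<^sup>-\<^sup>1 Var 2) \<triangleleft>\<^sup>-\<^sup>1 (Var 1 \<triangleleft>\<^sup>-\<^sup>1 Var 2)"]
    ax_inst[of "(Var 0 \<triangleleft> Var 1) \<triangleleft>\<^sup>-\<^sup>1 Var 1" "Var 0"]
    ax_inst[of "(Var 0 \<triangleleft>\<^sup>-\<^sup>1 Var 1) \<triangleleft> Var 1" "Var 0"]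
    ax_inst[of "Var 0 \<triangleleft> Var 0" "Var 0"]
    ax_inst[of "Var 0 \<triangleleft>\<^sup>-\<^sup>1 Var 0" "Var 0"]
  by (simp_all add: quandle_axioms_def Let_def \<sigma>_def)

end

text \<open>The sign lets both operations be treated at once; it becomes the first component of a
  letter when words act on terms.\<close>

definition qop :: "bool \<Rightarrow> 'c qterm \<Rightarrow> 'c qterm \<Rightarrow> 'c qterm" where
  "qop b s t = (if b then s \<triangleleft> t else s \<triangleleft>\<^sup>-\<^sup>1 t)"

lemma qop_in [simp]:
  "qop b s t \<in> terms_over C \<longleftrightarrow> s \<in> terms_over C \<and> t \<in> terms_over C"
  "qop b s t \<in> closed_terms C \<longleftrightarrow> s \<in> closed_terms C \<and> t \<in> closed_terms C"
  by (simp_all add: qop_def)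

lemma qop_cong:
  "provable C s s' \<Longrightarrow> provable C t t' \<Longrightarrow> provable C (qop b s t) (qop b s' t')"
  by (simp add: qop_def provable.cong provable.cong_inv)

lemma qop_cancel:
  assumes "s \<in> terms_over C" "t \<in> terms_over C"
  shows "provable C (qop (\<not> b) (qop b s t) t) s"
  using provable_axioms(3,4)[OF assms(1,2,2)] by (simp add: qop_def)

lemma qop_self: "s \<in> terms_over C \<Longrightarrow> provable C (qop b s s) s"
  by (simp add: qop_def provable_axioms)

text \<open>Right translation by \<open>u\<close>, in either direction, respects both operations.
  The axioms give this for equal signs; the mixed cases follow because right translations can be
  undone.\<close>

lemma qop_distrib:
  assumes "s \<in> terms_over C" "t \<in> terms_over C" "u \<in> terms_over C"
  shows "provable C (qop e (qop d s t) u) (qop d (qop e s u) (qop e t u))"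
proof -
  note ax = provable_axioms and [intro] = provable.refl
  \<comment> \<open>Translating the left side by \<open>t \<triangleleft> u\<close> gives
    \<open>s \<triangleleft> u\<close>; undoing that translation gives the claim.\<close>
  have TF: "provable C ((s \<triangleleft>\<^sup>-\<^sup>1 t) \<triangleleft> u) ((s \<triangleleft> u) \<triangleleft>\<^sup>-\<^sup>1 (t \<triangleleft> u))"
  proof -
    let ?p = "(s \<triangleleft>\<^sup>-\<^sup>1 t) \<triangleleft> u"
    have "provable C (?p \<triangleleft> (t \<triangleleft> u)) (((s \<triangleleft>\<^sup>-\<^sup>1 t) \<triangleleft> t) \<triangleleft> u)"
      using assms by (intro provable.sym[OF ax(1)]) auto
    also have "provable C \<dots> (s \<triangleleft> u)"
      using assms by (intro provable.cong ax(4)) auto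
    finally have "provable C ((?p \<triangleleft> (t \<triangleleft> u)) \<triangleleft>\<^sup>-\<^sup>1 (t \<triangleleft> u)) ((s \<triangleleft> u) \<triangleleft>\<^sup>-\<^sup>1 (t \<triangleleft> u))"
      using assms by (intro provable.cong_inv) auto
    moreover have "provable C ?p ((?p \<triangleleft> (t \<triangleleft> u)) \<triangleleft>\<^sup>-\<^sup>1 (t \<triangleleft> u))"
      using assms by (intro provable.sym[OF ax(3)]) auto
    ultimately show ?thesis
      by (rule provable.trans[rotated])
  qed
  \<comment> \<open>Here the intended right side is translated by \<open>u\<close>, which gives
    \<open>s \<triangleleft> t\<close>, and the translation is then undone.\<close>
  have FT: "provable C ((s \<triangleleft> t) \<triangleleft>\<^sup>-\<^sup>1 u) ((s \<triangleleft>\<^sup>-\<^sup>1 u) \<triangleleft> (t \<triangleleft>\<^sup>-\<^sup>1 u))"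
  proof -
    let ?a = "s \<triangleleft>\<^sup>-\<^sup>1 u" and ?b = "t \<triangleleft>\<^sup>-\<^sup>1 u"
    have "provable C ((?a \<triangleleft> ?b) \<triangleleft> u) ((?a \<triangleleft> u) \<triangleleft> (?b \<triangleleft> u))"
      using assms by (intro ax(1)) auto
    also have "provable C \<dots> (s \<triangleleft> t)"
      using assms by (intro provable.cong ax(4)) auto
    finally have "provable C ((s \<triangleleft> t) \<triangleleft>\<^sup>-\<^sup>1 u) (((?a \<triangleleft> ?b) \<triangleleft> u) \<triangleleft>\<^sup>-\<^sup>1 u)"
      using assms by (intro provable.cong_inv) (auto intro: provable.sym)
    also have "provable C \<dots> (?a \<triangleleft> ?b)"
      using assms by (intro ax(3)) auto
    finally show ?thesis .
  qed
  show ?thesis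
    using TF FT ax(1,2)[OF assms] by (cases e; cases d) (simp_all add: qop_def)
qed

section \<open>Substitution for a constant\<close>

lemma replace_const_qop [simp]:
  "replace_const x r (qop b s t) = qop b (replace_const x r s) (replace_const x r t)"
  by (simp add: qop_def)

lemma replace_const_inst:
  "constants t = {} \<Longrightarrow> replace_const x r (inst \<sigma> t) = inst (\<lambda>v. replace_const x r (\<sigma> v)) t"
  by (induction t) auto

lemma replace_const_terms_over:
  assumes "r \<in> terms_over D" "C - {x} \<subseteq> D" "t \<in> terms_over C"
  shows "replace_const x r t \<in> terms_over D"
  using assms(3) by (induction t) (use assms(1,2) in auto)

lemma replace_const_closed_terms:
  assumes "r \<in> closed_terms D" "C - {x} \<subseteq> D" "t \<in> closed_terms C"
  shows "replace_const x r t \<in> closed_terms D"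
  using assms(3) by (induction t) (use assms(1,2) in auto)

text \<open>The axioms contain no constants, so a substitution for \<open>x\<close> passes into the
  assignment \<open>\<sigma>\<close> and turns derivations into derivations.\<close>

lemma provable_replace_const:
  assumes "r \<in> terms_over D" "C - {x} \<subseteq> D" "provable C s t"
  shows "provable D (replace_const x r s) (replace_const x r t)"
  using assms(3)
proof induction
  case (ax l r' \<sigma>)
  have "constants l = {}" "constants r' = {}"
    using ax(1) by (auto simp: quandle_axioms_def Let_def)
  moreover have "provable D (inst (\<lambda>v. replace_const x r (\<sigma> v)) l)
      (inst (\<lambda>v. replace_const x r (\<sigma> v)) r')"
    using ax assms(1,2) by (intro provable.ax) (auto intro: replace_const_terms_over)
  ultimately show ?case
    by (simp add: replace_const_inst)
qed (auto intro: provable.intros replace_const_terms_over[OF assms(1,2)])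

lemma provable_replace_const_arg:
  assumes "provable D r r'" "C - {x} \<subseteq> D" "t \<in> terms_over C"
  shows "provable D (replace_const x r t) (replace_const x r' t)"
  using assms(3)
proof (induction t)
  case (Const c)
  then show ?case
    using assms(1,2) by (auto intro!: provable.refl)
qed (auto intro: provable.intros)

lemma equiv_provable_rel: "equiv (closed_terms C) (provable_rel C)"
  by (rule equivI)
    (auto simp: provable_rel_def refl_on_def sym_def trans_def
      intro: provable.intros closed_terms_subset)


section \<open>Words acting on terms\<close>

definition letter_inv :: "bool \<times> 'c \<Rightarrow> bool \<times> 'c" where
  "letter_inv a = (\<not> fst a, snd a)"

definition word_inv :: "(bool \<times> 'c) list \<Rightarrow> (bool \<times> 'c) list" where
  "word_inv w = rev (map letter_inv w)"

definition act_letter :: "bool \<times> 'c \<Rightarrow> 'c qterm \<Rightarrow> 'c qterm" where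
  "act_letter a t = qop (fst a) t (Const (snd a))"

text \<open>With \<open>foldr\<close> the last letter acts first, so concatenation of words is
  composition. This order matches the product \<open>t[s/X]\<close> and makes the later map a
  homomorphism rather than an antihomomorphism.\<close>

definition act :: "(bool \<times> 'c) list \<Rightarrow> 'c qterm \<Rightarrow> 'c qterm" where
  "act = foldr act_letter"

lemma letter_inv_simps [simp]:
  "letter_inv (letter_inv a) = a" "snd (letter_inv a) = snd a" "letter_inv a \<noteq> a" "a \<noteq> letter_inv a"
  by (auto simp: letter_inv_def prod_eq_iff)

lemma word_inv_simps [simp]:
  "word_inv [] = []" "word_inv (a # w) = word_inv w @ [letter_inv a]"
  "word_inv (v @ w) = word_inv w @ word_inv v" "word_inv (word_inv w) = w"
  by (simp_all add: word_inv_def rev_map o_def)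

lemma words_simps [simp]:
  "[] \<in> words A" "a # w \<in> words A \<longleftrightarrow> snd a \<in> A \<and> w \<in> words A"
  "v @ w \<in> words A \<longleftrightarrow> v \<in> words A \<and> w \<in> words A"
  by (auto simp: words_def mem_Times_iff)

lemma word_inv_in_words [simp]: "word_inv w \<in> words A \<longleftrightarrow> w \<in> words A"
  by (induction w) auto

lemma act_simps [simp]:
  "act [] t = t" "act (a # w) t = act_letter a (act w t)" "act (v @ w) t = act v (act w t)"
  by (simp_all add: act_def)

lemma act_letter_in [simp]:
  "act_letter a t \<in> terms_over C \<longleftrightarrow> t \<in> terms_over C \<and> snd a \<in> C"
  "act_letter a t \<in> closed_terms C \<longleftrightarrow> t \<in> closed_terms C \<and> snd a \<in> C"
  by (simp_all add: act_letter_def)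

lemma act_in [simp]:
  "act w t \<in> terms_over C \<longleftrightarrow> t \<in> terms_over C \<and> w \<in> words C"
  "act w t \<in> closed_terms C \<longleftrightarrow> t \<in> closed_terms C \<and> w \<in> words C"
  by (induction w) auto

lemma act_letter_cong:
  "provable C s t \<Longrightarrow> snd a \<in> C \<Longrightarrow> provable C (act_letter a s) (act_letter a t)"
  by (simp add: act_letter_def qop_cong provable.refl)

lemma act_cong: "provable C s t \<Longrightarrow> w \<in> words C \<Longrightarrow> provable C (act w s) (act w t)"
  by (induction w) (auto intro: act_letter_cong)

lemma act_letter_cancel:
  assumes "t \<in> terms_over C" "snd a \<in> C"
  shows "provable C (act_letter a (act_letter (letter_inv a) t)) t"
  using qop_cancel[of t C "Const (snd a)" "\<not> fst a"] assms
  by (simp add: act_letter_def letter_inv_def)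

lemma act_cancel:
  "t \<in> terms_over C \<Longrightarrow> w \<in> words C \<Longrightarrow> provable C (act w (act (word_inv w) t)) t"
proof (induction w arbitrary: t)
  case (Cons a w)
  have "provable C (act_letter a (act w (act (word_inv w) (act_letter (letter_inv a) t))))
      (act_letter a (act_letter (letter_inv a) t))"
    using Cons by (intro act_letter_cong Cons.IH) auto
  also have "provable C \<dots> t"
    using Cons.prems by (intro act_letter_cancel) auto
  finally show ?case
    by simp
qed (auto intro: provable.refl)

text \<open>Up to provable equality the action factors through the free group, as cancelling letters
  undo each other.\<close>

lemma act_word_eq:
  assumes "word_eq A v w" "A \<subseteq> C" "t \<in> terms_over C"
  shows "provable C (act v t) (act w t)"
  using assms(1)
proof induction
  case (cancel u v a b)
  have *: "words A \<subseteq> words C"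
    using assms(2) by (auto simp: words_def)
  have "provable C (act_letter (b, a) (act_letter (\<not> b, a) (act v t))) (act v t)"
    using act_letter_cancel[of "act v t" C "(b, a)"] cancel assms *
    by (auto simp: letter_inv_def)
  then show ?case
    using cancel * by (auto intro!: act_cong)
next
  case (refl u)
  then show ?case
    using assms by (intro provable.refl) (auto simp: words_def)
qed (auto intro: provable.intros)

text \<open>Iterated \<open>qop_distrib\<close>: words act as endomorphisms. This is the source of
  generic commutation.\<close>

lemma act_qop:
  assumes "s \<in> terms_over C" "t \<in> terms_over C" "w \<in> words C"
  shows "provable C (act w (qop d s t)) (qop d (act w s) (act w t))"
  using assms(3)
proof (induction w)
  case Nil
  then show ?case
    using assms by (auto intro: provable.refl)
next
  case (Cons a w)
  have "provable C (act_letter a (act w (qop d s t))) (act_letter a (qop d (act w s) (act w t)))"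
    using Cons by (intro act_letter_cong) auto
  also have "provable C \<dots> (qop d (act_letter a (act w s)) (act_letter a (act w t)))"
    unfolding act_letter_def using Cons assms by (intro qop_distrib) auto
  finally show ?case
    by simp
qed

text \<open>Since \<open>v\<close> acts as an automorphism, translation by \<open>act v t\<close> is
  translation by \<open>t\<close> conjugated by \<open>v\<close>.\<close>

lemma qop_act:
  assumes "s \<in> terms_over C" "t \<in> terms_over C" "v \<in> words C"
  shows "provable C (qop d s (act v t)) (act v (qop d (act (word_inv v) s) t))"
proof -
  have "provable C (qop d s (act v t)) (qop d (act v (act (word_inv v) s)) (act v t))"
    using assms by (intro qop_cong provable.sym[OF act_cancel] provable.refl) auto
  also have "provable C \<dots> (act v (qop d (act (word_inv v) s) t))"
    using assms by (intro provable.sym[OF act_qop]) auto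
  finally show ?thesis .
qed

text \<open>By \<open>qop_act\<close>, translation by \<open>act v (Const d)\<close> is the action
  of the word \<open>v @ (b, d) # word_inv v\<close>. Hence right arguments are absorbed into the
  word and only the leftmost constant remains as base.\<close>

lemma closed_term_normal_form:
  assumes "t \<in> closed_terms C"
  obtains c w where "c \<in> C" "w \<in> words C" "provable C t (act w (Const c))"
proof -
  have step: "\<exists>c w. c \<in> C \<and> w \<in> words C \<and> provable C (qop b s t) (act w (Const c))"
    if s: "c \<in> C" "w \<in> words C" "provable C s (act w (Const c))"
      and t: "d \<in> C" "v \<in> words C" "provable C t (act v (Const d))" for b s t c d v w
  proof -
    have "provable C (qop b s t) (qop b (act w (Const c)) (act v (Const d)))"
      using s t by (intro qop_cong)
    also have "provable C \<dots> (act v (qop b (act (word_inv v) (act w (Const c))) (Const d)))"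
      using s t by (intro qop_act) auto
    also have "\<dots> = act (v @ (b, d) # word_inv v @ w) (Const c)"
      by (simp add: act_letter_def)
    finally show ?thesis
      using s t by (intro exI[of _ c] exI[of _ "v @ (b, d) # word_inv v @ w"]) auto
  qed
  have "\<exists>c w. c \<in> C \<and> w \<in> words C \<and> provable C t (act w (Const c))"
    using assms
  proof (induction t)
    case (Const c)
    then show ?case
      by (intro exI[of _ c] exI[of _ "[]"]) (auto intro: provable.refl)
  next
    case (Rhd s t)
    then show ?case
      using step[where b = True and s = s and t = t] by (auto simp: qop_def)
  next
    case (RhdInv s t)
    then show ?case
      using step[where b = False and s = s and t = t] by (auto simp: qop_def)
  qed auto
  with that show thesis
    by blast
qed

lemma replace_const_act:
  "w \<in> words A \<Longrightarrow> x \<notin> A \<Longrightarrow> replace_const x r (act w t) = act w (replace_const x r t)"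
  by (induction w) (auto simp: act_letter_def)


section \<open>Soundness\<close>

locale quandle =
  fixes M :: "'m set" and rhd :: "'m \<Rightarrow> 'm \<Rightarrow> 'm" and rhd_inv :: "'m \<Rightarrow> 'm \<Rightarrow> 'm"
  assumes closed: "a \<in> M \<Longrightarrow> b \<in> M \<Longrightarrow> rhd a b \<in> M"
    and closed_inv: "a \<in> M \<Longrightarrow> b \<in> M \<Longrightarrow> rhd_inv a b \<in> M"
    and distrib: "a \<in> M \<Longrightarrow> b \<in> M \<Longrightarrow> c \<in> M \<Longrightarrow>
      rhd (rhd a b) c = rhd (rhd a c) (rhd b c)"
    and distrib_inv: "a \<in> M \<Longrightarrow> b \<in> M \<Longrightarrow> c \<in> M \<Longrightarrow>
      rhd_inv (rhd_inv a b) c = rhd_inv (rhd_inv a c) (rhd_inv b c)"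
    and cancel: "a \<in> M \<Longrightarrow> b \<in> M \<Longrightarrow> rhd_inv (rhd a b) b = a"
    and cancel_inv: "a \<in> M \<Longrightarrow> b \<in> M \<Longrightarrow> rhd (rhd_inv a b) b = a"
    and idem: "a \<in> M \<Longrightarrow> rhd a a = a"
    and idem_inv: "a \<in> M \<Longrightarrow> rhd_inv a a = a"
begin

primrec eval :: "(nat \<Rightarrow> 'm) \<Rightarrow> ('c \<Rightarrow> 'm) \<Rightarrow> 'c qterm \<Rightarrow> 'm" where
  "eval \<rho> \<alpha> (Var v) = \<rho> v"
| "eval \<rho> \<alpha> (Const c) = \<alpha> c"
| "eval \<rho> \<alpha> (s \<triangleleft> t) = rhd (eval \<rho> \<alpha> s) (eval \<rho> \<alpha> t)"
| "eval \<rho> \<alpha> (s \<triangleleft>\<^sup>-\<^sup>1 t) = rhd_inv (eval \<rho> \<alpha> s) (eval \<rho> \<alpha> t)"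

lemma eval_in:
  assumes "range \<rho> \<subseteq> M" "\<alpha> ` C \<subseteq> M" "t \<in> terms_over C"
  shows "eval \<rho> \<alpha> t \<in> M"
  using assms(3) by (induction t) (use assms(1,2) in \<open>auto intro: closed closed_inv\<close>)

lemma eval_inst:
  "constants t = {} \<Longrightarrow> eval \<rho> \<alpha> (inst \<sigma> t) = eval (\<lambda>v. eval \<rho> \<alpha> (\<sigma> v)) \<alpha> t"
  by (induction t) auto

text \<open>Turns the substitution instances in the definition of isotropy into evaluations of one
  term under changed assignments.\<close>

lemma eval_replace_const:
  "vars t = {} \<Longrightarrow> eval \<rho> \<alpha> (replace_const x r t) = eval \<rho> (\<alpha>(x := eval \<rho> \<alpha> r)) t"
  by (induction t) auto

lemma eval_quandle_axioms:
  assumes "range \<rho> \<subseteq> M" "(l, r) \<in> quandle_axioms"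
  shows "eval \<rho> \<alpha> l = eval \<rho> \<alpha> r"
proof -
  have "\<rho> v \<in> M" for v
    using assms(1) by blast
  then show ?thesis
    using assms(2) unfolding quandle_axioms_def Let_def
    \<comment> \<open>Read from right to left, the distributive laws shorten terms.\<close>
    by (elim insertE) (simp_all add: distrib[symmetric] distrib_inv[symmetric] cancel cancel_inv idem idem_inv)
qed

theorem soundness:
  assumes "range \<rho> \<subseteq> M" "\<alpha> ` C \<subseteq> M" "provable C s t"
  shows "eval \<rho> \<alpha> s = eval \<rho> \<alpha> t"
  using assms(3)
proof induction
  case (ax l r \<sigma>)
  have "constants l = {}" "constants r = {}"
    using ax(1) by (auto simp: quandle_axioms_def Let_def)
  moreover have "range (\<lambda>v. eval \<rho> \<alpha> (\<sigma> v)) \<subseteq> M"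
    using ax(2) eval_in[OF assms(1,2)] by auto
  ultimately show ?case
    using eval_quandle_axioms[OF _ ax(1)] by (simp add: eval_inst)
qed auto

end

text \<open>
  A permutation is represented by the pair of itself and its inverse.
\<close>

type_synonym 'a point_perm = "'a + ('a \<Rightarrow> 'a) \<times> ('a \<Rightarrow> 'a)"

fun pp_rhd :: "'a point_perm \<Rightarrow> 'a point_perm \<Rightarrow> 'a point_perm" where
  "pp_rhd (Inl a) (Inl b) = Inl a"
| "pp_rhd (Inl a) (Inr (f, g)) = Inl (f a)"
| "pp_rhd (Inr p) (Inl b) = Inr p"
| "pp_rhd (Inr (f, g)) (Inr (f', g')) = Inr (f' \<circ> f \<circ> g', f' \<circ> g \<circ> g')"

text \<open>\<open>prod.swap\<close> inverts a permutation, so this is the action of the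
  inverse.\<close>

definition pp_rhd_inv :: "'a point_perm \<Rightarrow> 'a point_perm \<Rightarrow> 'a point_perm" where
  "pp_rhd_inv p q = pp_rhd p (map_sum id prod.swap q)"

lemma pp_rhd_inv_simps [simp]:
  "pp_rhd_inv (Inl a) (Inl b) = Inl a"
  "pp_rhd_inv (Inl a) (Inr (f, g)) = Inl (g a)"
  "pp_rhd_inv (Inr p) (Inl b) = Inr p"
  "pp_rhd_inv (Inr (f, g)) (Inr (f', g')) = Inr (g' \<circ> f \<circ> f', g' \<circ> g \<circ> f')"
  by (simp_all add: pp_rhd_inv_def)

definition point_perms :: "'a point_perm set" where
  "point_perms = range Inl \<union> Inr ` {(f, g). f \<circ> g = id \<and> g \<circ> f = id}"

lemma point_perms_simps [simp]:
  "Inl a \<in> point_perms"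
  "Inr (f, g) \<in> point_perms \<longleftrightarrow> (\<forall>a. f (g a) = a) \<and> (\<forall>a. g (f a) = a)"
  by (auto simp: point_perms_def fun_eq_iff)

lemma point_permsE:
  assumes "p \<in> point_perms"
  obtains a where "p = Inl a"
  | f g where "p = Inr (f, g)" "\<And>a. f (g a) = a" "\<And>a. g (f a) = a"
  using assms by (cases p) auto

interpretation point_perm: quandle "point_perms :: 'a point_perm set" pp_rhd pp_rhd_inv
proof
  fix a b c :: "'a point_perm"
  assume "a \<in> point_perms"
  then show "pp_rhd a a = a" "pp_rhd_inv a a = a"
    by (auto elim!: point_permsE simp: fun_eq_iff)
  assume "b \<in> point_perms"
  with \<open>a \<in> point_perms\<close>
  show "pp_rhd a b \<in> point_perms" "pp_rhd_inv a b \<in> point_perms"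
    "pp_rhd_inv (pp_rhd a b) b = a" "pp_rhd (pp_rhd_inv a b) b = a"
    by (auto elim!: point_permsE simp: fun_eq_iff)
  assume "c \<in> point_perms"
  with \<open>a \<in> point_perms\<close> \<open>b \<in> point_perms\<close>
  show "pp_rhd (pp_rhd a b) c = pp_rhd (pp_rhd a c) (pp_rhd b c)"
    "pp_rhd_inv (pp_rhd_inv a b) c = pp_rhd_inv (pp_rhd_inv a c) (pp_rhd_inv b c)"
    by (auto elim!: point_permsE simp: fun_eq_iff)
qed


section \<open>The coset space\<close>

text \<open>One representative for each left coset of the powers of \<open>x\<close>: a reduced word
  stripped of its trailing powers of \<open>x\<close>.\<close>

fun coset_rep :: "'c \<Rightarrow> (bool \<times> 'c) list \<Rightarrow> bool" where
  "coset_rep x [] \<longleftrightarrow> True"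
| "coset_rep x [a] \<longleftrightarrow> snd a \<noteq> x"
| "coset_rep x (a # b # r) \<longleftrightarrow> b \<noteq> letter_inv a \<and> coset_rep x (b # r)"

text \<open>Other lists are fixed, so that every letter is a permutation of the whole type.\<close>

definition push :: "'c \<Rightarrow> bool \<times> 'c \<Rightarrow> (bool \<times> 'c) list \<Rightarrow> (bool \<times> 'c) list" where
  "push x a r =
    (if \<not> coset_rep x r then r
     else if r = [] then (if snd a = x then [] else [a])
     else if hd r = letter_inv a then tl r else a # r)"

definition pushes :: "'c \<Rightarrow> (bool \<times> 'c) list \<Rightarrow> (bool \<times> 'c) list \<Rightarrow> (bool \<times> 'c) list" where
  "pushes x = foldr (push x)"

lemma pushes_simps [simp]:
  "pushes x [] r = r" "pushes x (a # w) r = push x a (pushes x w r)"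
  "pushes x (v @ w) r = pushes x v (pushes x w r)"
  by (simp_all add: pushes_def)

text \<open>The cases correspond to idempotence, cancellation and no simplification. The last one
  includes \<open>r = []\<close> with \<open>snd a \<noteq> x\<close>.\<close>

lemma push_cases:
  assumes "coset_rep x r"
  obtains (base) "r = []" "snd a = x" "push x a r = []"
  | (pop) q where "r = letter_inv a # q" "push x a r = q"
  | (cons) "push x a r = a # r"
proof (cases r)
  case Nil
  then show thesis
    using that by (cases "snd a = x") (auto simp: push_def)
next
  case (Cons b q)
  then show thesis
    using that assms by (cases "b = letter_inv a") (auto simp: push_def)
qed

lemma coset_rep_push: "coset_rep x r \<Longrightarrow> coset_rep x (push x a r)"
  by (cases "(x, r)" rule: coset_rep.cases) (auto simp: push_def)

lemma coset_rep_pushes: "coset_rep x r \<Longrightarrow> coset_rep x (pushes x w r)"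
  by (induction w) (auto intro: coset_rep_push)

text \<open>Valid for arbitrary lists, because those that are not representatives are fixed. Thus
  letters give permutations of the whole type.\<close>

lemma push_push_inv [simp]: "push x (letter_inv a) (push x a r) = r"
  by (cases "(x, r)" rule: coset_rep.cases) (auto simp: push_def)

lemma pushes_inv_pushes [simp]: "pushes x (word_inv w) (pushes x w r) = r"
  by (induction w arbitrary: r) auto

lemma pushes_pushes_inv [simp]: "pushes x w (pushes x (word_inv w) r) = r"
  using pushes_inv_pushes[of x "word_inv w" r] by simp

text \<open>On a nonempty representative a push changes the length by one; the empty one absorbs
  \<open>x\<close>.\<close>

lemma push_fixed_iff:
  assumes "coset_rep x r"
  shows "push x (b, x) r = r \<longleftrightarrow> r = []"
  using assms by (cases r) (auto simp: push_def)

lemma pushes_in_words: "w \<in> words A \<Longrightarrow> pushes x w [] \<in> words A"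
proof (induction w)
  case (Cons a w)
  then show ?case
    by (cases "pushes x w []") (auto simp: push_def)
qed auto

text \<open>Passing to the coset representative is provable in the theory: absorbing
  \<open>x\<close> at the base is idempotence, removing a letter is cancellation. So words that
  agree on the trivial coset give provably equal terms.\<close>

lemma act_pushes:
  assumes "x \<in> C" "w \<in> words C"
  shows "provable C (act w (Const x)) (act (pushes x w []) (Const x))"
  using assms(2)
proof (induction w)
  case Nil
  then show ?case
    using assms by (auto intro: provable.refl)
next
  case (Cons a w)
  let ?r = "pushes x w []"
  have r: "?r \<in> words C"
    using Cons by (auto intro: pushes_in_words)
  have "provable C (act_letter a (act w (Const x))) (act_letter a (act ?r (Const x)))"
    using Cons by (auto intro: act_letter_cong)
  also have "provable C \<dots> (act (push x a ?r) (Const x))"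
  proof (rule push_cases[of x ?r a])
    show "coset_rep x ?r"
      by (simp add: coset_rep_pushes)
  \<comment> \<open>The restricted unfolding exposes \<open>qop\<close> only where a letter meets a
    constant, so that \<open>qop_self\<close> settles the case \<open>base\<close>.\<close>
  qed (use assms Cons r in \<open>auto simp: act_letter_def[of _ "Const _"]
      intro!: qop_self act_letter_cancel provable.refl\<close>)
  finally show ?case
    by simp
qed


section \<open>Free groups\<close>

lemma word_eq_in_words: "word_eq A u v \<Longrightarrow> u \<in> words A \<and> v \<in> words A"
  by (induction rule: word_eq.induct) auto

lemma equiv_word_rel: "equiv (words A) (word_rel A)"
  by (rule equivI)
    (auto simp: word_rel_def refl_on_def sym_def trans_def
      dest: word_eq_in_words intro: word_eq.intros)

declare word_eq.trans [trans]

lemma word_class_eq_iff: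
  "u \<in> words A \<Longrightarrow> v \<in> words A \<Longrightarrow> word_rel A `` {u} = word_rel A `` {v} \<longleftrightarrow> word_eq A u v"
  using eq_equiv_class_iff[OF equiv_word_rel] by (auto simp: word_rel_def)

lemma word_eq_append_left: "word_eq A u v \<Longrightarrow> w \<in> words A \<Longrightarrow> word_eq A (w @ u) (w @ v)"
proof (induction rule: word_eq.induct)
  case (cancel u v a b)
  then show ?case
    using word_eq.cancel[of "w @ u" A v a b] by auto
qed (auto intro: word_eq.intros)

lemma word_eq_append_right: "word_eq A u v \<Longrightarrow> w \<in> words A \<Longrightarrow> word_eq A (u @ w) (v @ w)"
proof (induction rule: word_eq.induct)
  case (cancel u v a b)
  then show ?case
    using word_eq.cancel[of u A "v @ w" a b] by auto
qed (auto intro: word_eq.intros)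

lemma word_eq_letter_inv:
  "v \<in> words A \<Longrightarrow> snd a \<in> A \<Longrightarrow> word_eq A (a # letter_inv a # v) v"
  using word_eq.cancel[of "[]" A v "snd a" "fst a"] by (simp add: letter_inv_def)

lemma word_eq_inv: "w \<in> words A \<Longrightarrow> word_eq A (word_inv w @ w) []"
proof (induction w)
  case (Cons a w)
  have "word_eq A (word_inv w @ letter_inv a # a # w) (word_inv w @ w)"
    using Cons word_eq_letter_inv[of w A "letter_inv a"] by (intro word_eq_append_left) auto
  also have "word_eq A \<dots> []"
    using Cons by simp
  finally show ?case
    by simp
qed (auto intro: word_eq.refl)

lemma free_group_mult:
  assumes "u \<in> words A" "v \<in> words A"
  shows "word_rel A `` {u} \<otimes>\<^bsub>free_group A\<^esub> word_rel A `` {v} = word_rel A `` {u @ v}"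
proof -
  have "congruent2 (word_rel A) (word_rel A) (\<lambda>u v. word_rel A `` {u @ v})"
  proof (rule congruent2I[OF equiv_word_rel equiv_word_rel])
    fix u v w
    assume "w \<in> words A" "(u, v) \<in> word_rel A"
    then have *: "word_eq A u v" "u \<in> words A" "v \<in> words A" "w \<in> words A"
      by (auto simp: word_rel_def dest: word_eq_in_words)
    show "word_rel A `` {u @ w} = word_rel A `` {v @ w}" "word_rel A `` {w @ u} = word_rel A `` {w @ v}"
      using * by (simp_all add: word_class_eq_iff word_eq_append_left word_eq_append_right)
  qed
  then show ?thesis
    using UN_equiv_class2[OF equiv_word_rel equiv_word_rel] assms by (simp add: free_group_def)
qed

lemma group_free_group: "group (free_group A)"
proof (rule groupI)
  have carrier: "x \<in> carrier (free_group A) \<longleftrightarrow> (\<exists>u \<in> words A. x = word_rel A `` {u})" for x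
    by (auto simp: free_group_def quotient_def)
  have one: "\<one>\<^bsub>free_group A\<^esub> = word_rel A `` {[]}"
    by (simp add: free_group_def)
  show "\<one>\<^bsub>free_group A\<^esub> \<in> carrier (free_group A)"
    using words_simps(1) carrier one by blast
  fix x y z
  assume "x \<in> carrier (free_group A)"
  then obtain u where u: "u \<in> words A" "x = word_rel A `` {u}"
    by (auto simp: carrier)
  show "\<one>\<^bsub>free_group A\<^esub> \<otimes>\<^bsub>free_group A\<^esub> x = x"
    by (simp add: one u free_group_mult)
  have "word_rel A `` {word_inv u} \<otimes>\<^bsub>free_group A\<^esub> x = \<one>\<^bsub>free_group A\<^esub>"
    using word_eq_inv[OF u(1)] u
    by (simp add: one free_group_mult word_class_eq_iff)
  then show "\<exists>y \<in> carrier (free_group A). y \<otimes>\<^bsub>free_group A\<^esub> x = \<one>\<^bsub>free_group A\<^esub>"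
    using u(1) carrier word_inv_in_words by blast
  assume "y \<in> carrier (free_group A)"
  then obtain v where v: "v \<in> words A" "y = word_rel A `` {v}"
    by (auto simp: carrier)
  show "x \<otimes>\<^bsub>free_group A\<^esub> y \<in> carrier (free_group A)"
    using u v by (auto simp: carrier free_group_mult intro!: bexI[of _ "u @ v"])
  assume "z \<in> carrier (free_group A)"
  then obtain w where w: "w \<in> words A" "z = word_rel A `` {w}"
    by (auto simp: carrier)
  show "x \<otimes>\<^bsub>free_group A\<^esub> y \<otimes>\<^bsub>free_group A\<^esub> z = x \<otimes>\<^bsub>free_group A\<^esub> (y \<otimes>\<^bsub>free_group A\<^esub> z)"
    using u v w by (simp add: free_group_mult)
qed

text \<open>Over letters other than \<open>x\<close> nothing is absorbed at the base, so
  \<open>pushes\<close> is plain free reduction.\<close>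

lemma word_eq_pushes:
  assumes "x \<notin> A" "w \<in> words A"
  shows "word_eq A w (pushes x w [])"
  using assms(2)
proof (induction w)
  case Nil
  then show ?case
    by (auto intro: word_eq.refl)
next
  case (Cons a w)
  let ?r = "pushes x w []"
  have r: "?r \<in> words A"
    using Cons by (auto intro: pushes_in_words)
  have "word_eq A (a # w) (a # ?r)"
    using Cons word_eq_append_left[of A w ?r "[a]"] by auto
  also have "word_eq A \<dots> (push x a ?r)"
  proof (rule push_cases[of x ?r a])
    show "coset_rep x ?r"
      by (simp add: coset_rep_pushes)
  qed (use assms Cons r in \<open>auto intro!: word_eq_letter_inv word_eq.refl\<close>)
  finally show ?case
    by simp
qed


section \<open>The isotropy group\<close>

abbreviation X_gens :: "nat \<Rightarrow> qconst set" where
  "X_gens n \<equiv> insert X (generators n)"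

abbreviation term_class :: "nat \<Rightarrow> qconst qterm \<Rightarrow> qconst qterm set" where
  "term_class n t \<equiv> provable_rel (X_gens n) `` {t}"

lemma not_in_generators [simp]: "X \<notin> generators n" "X0 \<notin> generators n" "X1 \<notin> generators n"
  by (auto simp: generators_def)

lemma words_mono: "A \<subseteq> B \<Longrightarrow> w \<in> words A \<Longrightarrow> w \<in> words B"
  by (auto simp: words_def)

lemma words_X_gens: "w \<in> words (generators n) \<Longrightarrow> w \<in> words (X_gens n)"
  by (auto intro: words_mono)

lemma term_class_eq_iff:
  "s \<in> closed_terms (X_gens n) \<Longrightarrow> t \<in> closed_terms (X_gens n) \<Longrightarrow>
    term_class n s = term_class n t \<longleftrightarrow> provable (X_gens n) s t"
  using eq_equiv_class_iff[OF equiv_provable_rel] by (auto simp: provable_rel_def)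

text \<open>The product is a union over representatives; substitution respects provable equality in
  both arguments, so all members of the union coincide.\<close>

lemma isotropy_mult:
  assumes "s \<in> closed_terms (X_gens n)" "t \<in> closed_terms (X_gens n)"
  shows "term_class n t \<otimes>\<^bsub>quandle_isotropy_group n\<^esub> term_class n s = term_class n (replace_const X s t)"
proof -
  let ?C = "X_gens n"
  have "congruent2 (provable_rel ?C) (provable_rel ?C) (\<lambda>t s. term_class n (replace_const X s t))"
  proof (rule congruent2I[OF equiv_provable_rel equiv_provable_rel])
    fix t t' s
    assume "s \<in> closed_terms ?C" "(t, t') \<in> provable_rel ?C"
    then show "term_class n (replace_const X s t) = term_class n (replace_const X s t')"
      by (subst term_class_eq_iff)
        (auto simp: provable_rel_def closed_terms_subset
          intro: replace_const_closed_terms provable_replace_const)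
  next
    fix t s s'
    assume "t \<in> closed_terms ?C" "(s, s') \<in> provable_rel ?C"
    then show "term_class n (replace_const X s t) = term_class n (replace_const X s' t)"
      by (subst term_class_eq_iff)
        (auto simp: provable_rel_def
          intro: replace_const_closed_terms provable_replace_const_arg dest: closed_terms_subset)
  qed
  then show ?thesis
    using UN_equiv_class2[OF equiv_provable_rel equiv_provable_rel] assms
    by (simp add: quandle_isotropy_group_def Let_def)
qed

section \<open>Words over the generators yield elements of the isotropy group\<close>

lemma generically_invertible_act:
  assumes "w \<in> words (generators n)"
  shows "generically_invertible n (act w (Const X))"
proof -
  have w: "w \<in> words (X_gens n)"
    using assms by (rule words_X_gens)
  have "provable (X_gens n) (Const X) (act (word_inv w) (act w (Const X)))"
    using act_cancel[of "Const X" "X_gens n" "word_inv w"] w by (auto intro: provable.sym)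
  then show ?thesis
    unfolding generically_invertible_def
    using assms w by (intro bexI[of _ "act (word_inv w) (Const X)"])
      (auto simp: replace_const_act[where A = "generators n"] intro: act_cancel)
qed

lemma commutes_generically_act:
  assumes "w \<in> words (generators n)"
  shows "commutes_generically n (act w (Const X))"
proof -
  have w: "w \<in> words ({X0, X1} \<union> generators n)"
    using assms by (rule words_mono[rotated]) auto
  show ?thesis
    using act_qop[OF _ _ w, of "Const X0" "Const X1" True] act_qop[OF _ _ w, of "Const X0" "Const X1" False] assms
    by (simp add: commutes_generically_def replace_const_act[where A = "generators n"] qop_def)
qed

text \<open>The terms of interest are closed, so \<open>Inl []\<close> is an arbitrary value for the
  variables.\<close>

abbreviation pp_eval :: "(qconst \<Rightarrow> (bool \<times> qconst) list point_perm) \<Rightarrow> qconst qterm \<Rightarrow> (bool \<times> qconst) list point_perm" where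
  "pp_eval \<equiv> point_perm.eval (\<lambda>_. Inl [])"

definition push_perm :: "qconst \<Rightarrow> (bool \<times> qconst) list point_perm" where
  "push_perm c = Inr (push X (True, c), push X (False, c))"

lemma push_perm_in [simp]: "push_perm c \<in> point_perms"
  using push_push_inv[of X "(True, c)"] push_push_inv[of X "(False, c)"]
  by (auto simp: push_perm_def letter_inv_def fun_eq_iff)

lemma pp_soundness:
  assumes "provable C s t" "\<And>c. c \<in> C \<Longrightarrow> \<alpha> c \<in> point_perms"
  shows "pp_eval \<alpha> s = pp_eval \<alpha> t"
  using assms by (intro point_perm.soundness) auto

text \<open>Points act trivially, so the letter \<open>X\<close> drops out when it is mapped to a point.\<close>

lemma pp_eval_act_point:
  assumes "w \<in> words (X_gens n)" "\<And>c. c \<in> generators n \<Longrightarrow> \<alpha> c = push_perm c" "\<alpha> X = Inl b"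
    and "pp_eval \<alpha> t = Inl a"
  shows "pp_eval \<alpha> (act w t) = Inl (pushes X (filter (\<lambda>a. snd a \<noteq> X) w) a)"
  using assms(1)
proof (induction w)
  case (Cons c w)
  then show ?case
    using assms(2,3) by (cases c) (auto simp: act_letter_def qop_def push_perm_def)
qed (simp add: assms)

text \<open>Now \<open>X\<close> is a permutation too, so all of \<open>w\<close>, its letters
  \<open>X\<close> included, acts by conjugation.\<close>

lemma pp_eval_act_perm:
  assumes "w \<in> words (X_gens n)" "\<And>c. c \<in> X_gens n \<Longrightarrow> \<alpha> c = push_perm c"
    and "pp_eval \<alpha> t = Inr (f, g)"
  shows "pp_eval \<alpha> (act w t) =
    Inr (pushes X w \<circ> f \<circ> pushes X (word_inv w), pushes X w \<circ> g \<circ> pushes X (word_inv w))"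
  using assms(1)
proof (induction w)
  case (Cons c w)
  then show ?case
    using assms(2)
    by (cases c) (auto simp: act_letter_def qop_def push_perm_def letter_inv_def fun_eq_iff)
qed (simp add: assms fun_eq_iff)

text \<open>\<open>pp_rhd\<close> keeps its first argument on its side of the sum, so the base of a
  term decides whether its value is a point.\<close>

lemma pp_eval_act_Inr:
  assumes "\<exists>p. pp_eval \<alpha> t = Inr p"
  shows "\<exists>p. pp_eval \<alpha> (act w t) = Inr p"
proof (induction w)
  case (Cons a w)
  then obtain f g where "pp_eval \<alpha> (act w t) = Inr (f, g)"
    by auto
  then show ?case
    by (cases "\<alpha> (snd a)") (auto simp: act_letter_def qop_def)
qed (use assms in simp)

text \<open>With \<open>X\<close> read as the trivial coset and the generators as permutations,
  \<open>act w (Const X)\<close> evaluates to the free reduction of \<open>w\<close>.\<close>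

lemma inj_act:
  assumes "v \<in> words (generators n)" "w \<in> words (generators n)"
    and "provable (X_gens n) (act v (Const X)) (act w (Const X))"
  shows "word_eq (generators n) v w"
proof -
  let ?\<alpha> = "push_perm(X := Inl [])"
  have eval: "pp_eval ?\<alpha> (act u (Const X)) = Inl (pushes X u [])"
    if "u \<in> words (generators n)" for u
  proof -
    have "filter (\<lambda>a. snd a \<noteq> X) u = u"
      using that by (induction u) auto
    moreover have "?\<alpha> c = push_perm c" if "c \<in> generators n" for c
      using that by auto
    ultimately show ?thesis
      using pp_eval_act_point[of u n ?\<alpha> "[]" "Const X" "[]"] words_X_gens[OF that]
      by simp
  qed
  have "pushes X v [] = pushes X w []"
    using pp_soundness[OF assms(3), of ?\<alpha>] eval assms(1,2) by auto
  then show ?thesis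
    using word_eq_pushes[of X "generators n" v] word_eq_pushes[of X "generators n" w] assms(1,2)
    by (auto intro: word_eq.intros)
qed

text \<open>Read \<open>X\<close> as a point and the generators as permutations. A base other than
  \<open>X\<close> makes \<open>t[s/X]\<close> a permutation for every \<open>s\<close>, yet it
  should equal the point \<open>X\<close>.\<close>

lemma generically_invertible_leading_X:
  assumes "t \<in> closed_terms (X_gens n)" "generically_invertible n t"
    and "provable (X_gens n) t (act w (Const c))" "w \<in> words (X_gens n)" "c \<in> X_gens n"
  shows "c = X"
proof (rule ccontr)
  assume "c \<noteq> X"
  obtain s where s: "s \<in> closed_terms (X_gens n)"
    and inverse: "provable (X_gens n) (replace_const X s t) (Const X)"
    using assms(2) by (auto simp: generically_invertible_def)
  let ?\<alpha> = "push_perm(X := Inl [])"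
  let ?\<beta> = "?\<alpha>(X := pp_eval ?\<alpha> s)"
  have \<alpha>: "?\<alpha> d \<in> point_perms" for d
    by simp
  have in_pp: "pp_eval ?\<alpha> s \<in> point_perms"
    by (rule point_perm.eval_in[where C = UNIV]) (auto simp: terms_over_def)
  have act_Inr: "\<exists>p. pp_eval ?\<beta> (act w (Const c)) = Inr p"
    using \<open>c \<noteq> X\<close> by (intro pp_eval_act_Inr) (simp add: push_perm_def)
  have "Inl [] = pp_eval ?\<alpha> (replace_const X s t)"
    using pp_soundness[OF inverse, of ?\<alpha>] \<alpha> by simp
  also have "\<dots> = pp_eval ?\<beta> t"
    using assms(1) by (intro point_perm.eval_replace_const) (simp add: closed_terms_def)
  also have "\<dots> = pp_eval ?\<beta> (act w (Const c))"
    using assms(3) in_pp by (intro pp_soundness) auto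
  finally show False
    using act_Inr by auto
qed

lemma commutes_generically_imp_act:
  assumes t: "t \<in> closed_terms (X_gens n)" and "commutes_generically n t"
    and u: "u \<in> words (X_gens n)" "provable (X_gens n) t (act u (Const X))"
  shows "provable (X_gens n) t (act (filter (\<lambda>a. snd a \<noteq> X) u) (Const X))"
proof -
  \<comment> \<open>The point \<open>a\<close> is chosen so that \<open>u'\<close> moves it to the
    coset to which \<open>u\<close> moves the trivial one.\<close>
  define u' where "u' = filter (\<lambda>a. snd a \<noteq> X) u"
  define a where "a = pushes X (word_inv u') (pushes X u [])"
  have a: "coset_rep X a"
    by (simp add: a_def coset_rep_pushes)
  let ?\<alpha> = "push_perm(X0 := Inl a, X1 := push_perm X)"
  have eval_t: "pp_eval ?\<alpha> (replace_const X r t) = pp_eval (?\<alpha>(X := pp_eval ?\<alpha> r)) (act u (Const X))"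
    if "pp_eval ?\<alpha> r \<in> point_perms" for r
  proof -
    have "pp_eval ?\<alpha> (replace_const X r t) = pp_eval (?\<alpha>(X := pp_eval ?\<alpha> r)) t"
      using t by (intro point_perm.eval_replace_const) (simp add: closed_terms_def)
    also have "\<dots> = pp_eval (?\<alpha>(X := pp_eval ?\<alpha> r)) (act u (Const X))"
      using u(2) that by (intro pp_soundness) auto
    finally show ?thesis .
  qed
  \<comment> \<open>If \<open>r\<close> is a point, the letters \<open>X\<close> of \<open>u\<close>
    act trivially and only \<open>u'\<close> remains.\<close>
  have point: "pp_eval ?\<alpha> (replace_const X r t) = Inl (pushes X u' b)"
    if "pp_eval ?\<alpha> r = Inl b" for r b
    using that u unfolding u'_def
    by (subst eval_t, simp, intro pp_eval_act_point)
      (auto simp: generators_def)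
  have perm: "pp_eval ?\<alpha> (replace_const X (Const X1) t) =
      Inr (pushes X u \<circ> push X (True, X) \<circ> pushes X (word_inv u),
        pushes X u \<circ> push X (False, X) \<circ> pushes X (word_inv u))"
    using u
    by (subst eval_t, simp, intro pp_eval_act_perm)
      (auto simp: generators_def push_perm_def)
  have "provable ({X0, X1} \<union> generators n) (replace_const X (Const X0 \<triangleleft> Const X1) t)
      (replace_const X (Const X0) t \<triangleleft> replace_const X (Const X1) t)"
    using assms(2) by (simp add: commutes_generically_def)
  then have "pp_eval ?\<alpha> (replace_const X (Const X0 \<triangleleft> Const X1) t) =
      pp_eval ?\<alpha> (replace_const X (Const X0) t \<triangleleft> replace_const X (Const X1) t)"
    by (rule pp_soundness) auto
  moreover have "pp_eval ?\<alpha> (replace_const X (Const X0 \<triangleleft> Const X1) t) =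
      Inl (pushes X u' (push X (True, X) a))"
    by (rule point) (simp add: push_perm_def)
  ultimately have "pushes X u' (push X (True, X) a) =
      pushes X u (push X (True, X) (pushes X (word_inv u) (pushes X u' a)))"
    using point[of "Const X0" a] perm by simp
  \<comment> \<open>By choice of \<open>a\<close>, \<open>word_inv u\<close> returns to the trivial
    coset, which \<open>X\<close> fixes.\<close>
  also have "\<dots> = pushes X u []"
    by (simp add: a_def push_def)
  finally have fixed: "pushes X u' (push X (True, X) a) = pushes X u []" .
  \<comment> \<open>Cancelling \<open>u'\<close> shows that \<open>X\<close> fixes \<open>a\<close>,
    which forces \<open>a\<close> to be the trivial coset.\<close>
  have "push X (True, X) a = pushes X (word_inv u') (pushes X u' (push X (True, X) a))"
    by (rule pushes_inv_pushes[symmetric])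
  also have "\<dots> = a"
    unfolding fixed by (rule a_def[symmetric])
  finally have "a = []"
    by (rule iffD1[OF push_fixed_iff[OF a]])
  moreover have "pushes X u' a = pushes X u []"
    unfolding a_def by (rule pushes_pushes_inv)
  ultimately have eq: "pushes X u [] = pushes X u' []"
    by (simp only:)
  have u': "u' \<in> words (X_gens n)"
    using u by (auto simp: u'_def words_def)
  note u(2)
  also have "provable (X_gens n) (act u (Const X)) (act (pushes X u' []) (Const X))"
    using act_pushes[of X "X_gens n" u] u eq by simp
  also have "provable (X_gens n) \<dots> (act u' (Const X))"
    using u' by (intro provable.sym[OF act_pushes]) auto
  finally show ?thesis
    by (simp add: u'_def)
qed

text \<open>Each element has a normal form; invertibility makes its base \<open>X\<close>, and
  generic commutation deletes \<open>X\<close> from its word.\<close>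

lemma isotropy_carrier:
  "carrier (quandle_isotropy_group n) =
    (\<lambda>w. term_class n (act w (Const X))) ` words (generators n)"
proof (intro equalityI subsetI)
  fix T
  assume "T \<in> carrier (quandle_isotropy_group n)"
  then obtain t where t: "T = term_class n t" "t \<in> closed_terms (X_gens n)"
    "generically_invertible n t" "commutes_generically n t"
    by (auto simp: quandle_isotropy_group_def Let_def)
  obtain c u where "c \<in> X_gens n" "u \<in> words (X_gens n)" "provable (X_gens n) t (act u (Const c))"
    using closed_term_normal_form[OF t(2)] .
  moreover from this have "c = X"
    using generically_invertible_leading_X t by blast
  moreover define w where "w = filter (\<lambda>a. snd a \<noteq> X) u"
  ultimately have "provable (X_gens n) t (act w (Const X))" "w \<in> words (generators n)"
    using commutes_generically_imp_act t by (auto simp: words_def)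
  moreover from this have "w \<in> words (X_gens n)"
    by (simp add: words_X_gens)
  ultimately show "T \<in> (\<lambda>w. term_class n (act w (Const X))) ` words (generators n)"
    using t term_class_eq_iff[of t n "act w (Const X)"] by auto
next
  fix T
  assume "T \<in> (\<lambda>w. term_class n (act w (Const X))) ` words (generators n)"
  then obtain w where w: "w \<in> words (generators n)" "T = term_class n (act w (Const X))"
    by auto
  moreover have "act w (Const X) \<in> closed_terms (X_gens n)"
    using words_X_gens[OF w(1)] by auto
  ultimately show "T \<in> carrier (quandle_isotropy_group n)"
    using generically_invertible_act commutes_generically_act
    by (auto simp: quandle_isotropy_group_def Let_def free_quandle_def quotient_def)
qed

section \<open>The isomorphism from the free group\<close>

definition free_group_to_isotropy :: "nat \<Rightarrow> (bool \<times> qconst) list set \<Rightarrow> qconst qterm set" where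
  "free_group_to_isotropy n U = (\<Union>u\<in>U. term_class n (act u (Const X)))"

lemma act_X_closed [simp]:
  "w \<in> words (generators n) \<Longrightarrow> act w (Const X) \<in> closed_terms (X_gens n)"
  by (simp add: words_X_gens)

lemma free_group_to_isotropy_class:
  assumes "w \<in> words (generators n)"
  shows "free_group_to_isotropy n (word_rel (generators n) `` {w}) = term_class n (act w (Const X))"
proof -
  have "(\<lambda>u. term_class n (act u (Const X))) respects word_rel (generators n)"
  proof (rule congruentI)
    fix u v
    assume "(u, v) \<in> word_rel (generators n)"
    then have "word_eq (generators n) u v"
      by (simp add: word_rel_def)
    then show "term_class n (act u (Const X)) = term_class n (act v (Const X))"
      using word_eq_in_words[of "generators n" u v]
      by (subst term_class_eq_iff) (auto simp del: act_in intro: act_word_eq)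
  qed
  then show ?thesis
    unfolding free_group_to_isotropy_def by (rule UN_equiv_class[OF equiv_word_rel _ assms])
qed

lemma free_group_to_isotropy_iso:
  "free_group_to_isotropy n \<in> iso (free_group (generators n)) (quandle_isotropy_group n)"
    (is "?h \<in> iso ?F ?G")
proof -
  let ?A = "generators n"
  note h = free_group_to_isotropy_class
  have F: "carrier ?F = (\<lambda>u. word_rel ?A `` {u}) ` words ?A"
    by (auto simp: free_group_def quotient_def)
  have "?h \<in> hom ?F ?G"
  proof (rule homI)
    show "?h U \<in> carrier ?G" if "U \<in> carrier ?F" for U
      using that unfolding F isotropy_carrier by (auto simp only: h)
  next
    fix U V
    assume "U \<in> carrier ?F" "V \<in> carrier ?F"
    then obtain u v where uv: "u \<in> words ?A" "U = word_rel ?A `` {u}" "v \<in> words ?A" "V = word_rel ?A `` {v}"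
      by (auto simp: F)
    have "?h U \<otimes>\<^bsub>?G\<^esub> ?h V = term_class n (replace_const X (act v (Const X)) (act u (Const X)))"
      by (simp only: uv h isotropy_mult act_X_closed)
    \<comment> \<open>The letters of \<open>u\<close> avoid \<open>X\<close>, so substitution
      reaches only the base and concatenates the words.\<close>
    also have "\<dots> = term_class n (act (u @ v) (Const X))"
      using uv by (simp add: replace_const_act[where A = ?A])
    also have "\<dots> = ?h (U \<otimes>\<^bsub>?F\<^esub> V)"
      by (simp only: uv free_group_mult h words_simps)
    finally show "?h (U \<otimes>\<^bsub>?F\<^esub> V) = ?h U \<otimes>\<^bsub>?G\<^esub> ?h V"
      by simp
  qed
  moreover have "inj_on ?h (carrier ?F)"
  proof (rule inj_onI)
    fix U V
    assume "U \<in> carrier ?F" "V \<in> carrier ?F" and eq: "?h U = ?h V"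
    then obtain u v where uv: "u \<in> words ?A" "U = word_rel ?A `` {u}" "v \<in> words ?A" "V = word_rel ?A `` {v}"
      by (auto simp: F)
    then have "provable (X_gens n) (act u (Const X)) (act v (Const X))"
      using eq by (simp only: h term_class_eq_iff act_X_closed)
    then show "U = V"
      using uv by (simp add: word_class_eq_iff inj_act)
  qed
  moreover have "?h ` carrier ?F = carrier ?G"
    by (simp only: F isotropy_carrier image_image h cong: image_cong)
  ultimately show ?thesis
    by (simp add: iso_def bij_betw_def)
qed

theorem corollary3p5:
  fixes n :: nat
  shows "group (quandle_isotropy_group n) \<and> group (free_group (generators n)) \<and>
    quandle_isotropy_group n \<cong> free_group (generators n)"
proof -
  let ?F = "free_group (generators n)" and ?G = "quandle_isotropy_group n"
  interpret F: group ?F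
    by (rule group_free_group)
  \<comment> \<open>\<open>iso_imp_img_group\<close> gives a group whose unit is the image of the
    unit; this identifies it with the unit of \<open>?G\<close>.\<close>
  have "free_group_to_isotropy n \<one>\<^bsub>?F\<^esub> = \<one>\<^bsub>?G\<^esub>"
    using free_group_to_isotropy_class[of "[]" n]
    by (simp add: free_group_def quandle_isotropy_group_def Let_def)
  then have "?G\<lparr>one := free_group_to_isotropy n \<one>\<^bsub>?F\<^esub>\<rparr> = ?G"
    by simp
  then have "group ?G"
    using F.iso_imp_img_group[OF free_group_to_isotropy_iso] by simp
  moreover have "?G \<cong> ?F"
    using F.iso_set_sym[OF free_group_to_isotropy_iso] by (auto simp: is_iso_def)
  ultimately show ?thesis
    using F.is_group by blast
qed

end
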